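(* Let $n,N\ge 1$ be integers, $\hat A\in\mathbb{R}^{n\times n}$ with $i$-th row $\hat A_i$, and $\underline z,\bar z\in\mathbb{R}^n$ with $\underline z_i\le\bar z_i$ for all $i$. Let $z(0),\dots,z(N)\in\mathbb{R}^n$ and $\bar\alpha(k),\underline\alpha(k),\Delta(k)\in\mathbb{R}^n$ for $k=0,\dots,N-1$. Then the following two systems of conditions are equivalent. (I) For all $k\in\{0,\dots,N-1\}$ and all $i\in\{1,\dots,n\}$: \begin{align*} \text{(a)}\quad & z_i(k+1)=\bar\alpha_i(k)\,\underline\alpha_i(k)\,\big(\hat A_i z(k)\big)+(1-\bar\alpha_i(k))\,\bar z_i+(1-\underline\alpha_i(k))\,\underline z_i,\\ \text{(b)}\quad & \Delta_i(k)=\bar\alpha_i(k)\,\big(\bar z_i-\hat A_i z(k)\big)+\underline\alpha_i(k)\,\big(\hat A_i z(k)-\underline z_i\big),\\ \text{(c)}\quad & \bar\alpha_i(k)=1 \text{ if } \hat A_i z(k)\le\bar z_i,\qquad \bar\alpha_i(k)=0 \text{ if } \hat A_i z(k)>\bar z_i,\\ \text{(d)}\quad & \underline\alpha_i(k)=1 \text{ if } \hat A_i z(k)\ge\underline z_i,\qquad \underline\alpha_i(k)=0 \text{ if } \hat A_i z(k)<\underline z_i. \end{align*} (II) For all $k\in\{0,\dots,N-1\}$ and all $i\in\{1,\dots,n\}$, the equations (a) and (b) hold, and moreover \begin{align*} \text{(e)}\quad & \bar\alpha_i(k)\in\{0,1\}\ \text{ and }\ \underline\alpha_i(k)\in\{0,1\},\\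 \text{(f)}\quad & \Delta_i(k)\ge\bar z_i-\underline z_i,\\ \text{(g)}\quad & z(k+1)\in[\underline z,\bar z]. \end{align*}
   Context: For $x\in\mathbb{R}^n$, $x_i$ denotes its $i$-th entry. For $\underline z,\bar z\in\mathbb{R}^n$, $[\underline z,\bar z]$ denotes the box $\{x\in\mathbb{R}^n:\underline z_i\le x_i\le\bar z_i \text{ for all } i\}$. The vectors $\underline z$ and $\bar z$ are fixed bounds that do not depend on $k$. System (I) is a slack-variable form of the projected linear dynamics $z(k+1)=\mathrm{Proj}_{[\underline z,\bar z]}(\hat A z(k))$, where $\mathrm{Proj}_{\mathcal X}(x_0)=\operatorname{argmin}_{x\in\mathcal X}\|x-x_0\|$.
   Formalization: For fixed multipliers, (II)⇒(I) fails when some Â_i z(k) equals z̄_i or z̲_i, or z̲_i = z̄_i = 0; so the equivalence is proved outside these cases, while (I)⇒(II), and the equality of the sets of trajectories z admitted by (I) and (II), are proved always. *)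

theory Defs
  imports "HOL-Analysis.Analysis"
begin

text \<open>
  Throughout, \<open>zl\<close> and \<open>zu\<close> are the lower and upper bounds, \<open>al k\<close> and \<open>au k\<close> the
  under- and over-lined multipliers, \<open>D k\<close> the vector \<open>\<Delta>(k)\<close>, and \<open>(A *v z k) $ i\<close> is the product
  of the \<open>i\<close>-th row of \<open>A\<close> with \<open>z(k)\<close>. On \<open>real ^ 'n\<close> the order is componentwise, so
  \<open>{zl..zu}\<close> is the box. Only \<open>z 0, \<dots>, z N\<close> and the values of \<open>au\<close>, \<open>al\<close>, \<open>D\<close> at
  \<open>k < N\<close> matter.
\<close>

definition slack_dynamics ::
  "real ^ 'n ^ 'n \<Rightarrow> real ^ 'n \<Rightarrow> real ^ 'n \<Rightarrow> nat \<Rightarrow> (nat \<Rightarrow> real ^ 'n) \<Rightarrow>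
   (nat \<Rightarrow> real ^ 'n) \<Rightarrow> (nat \<Rightarrow> real ^ 'n) \<Rightarrow> (nat \<Rightarrow> real ^ 'n) \<Rightarrow> bool" where
  "slack_dynamics A zl zu N z au al D \<longleftrightarrow>
     (\<forall>k<N. \<forall>i.
        z (Suc k) $ i = au k $ i * al k $ i * ((A *v z k) $ i)
                        + (1 - au k $ i) * zu $ i + (1 - al k $ i) * zl $ i \<and>
        D k $ i = au k $ i * (zu $ i - (A *v z k) $ i)
                  + al k $ i * ((A *v z k) $ i - zl $ i))"

definition system_I ::
  "real ^ 'n ^ 'n \<Rightarrow> real ^ 'n \<Rightarrow> real ^ 'n \<Rightarrow> nat \<Rightarrow> (nat \<Rightarrow> real ^ 'n) \<Rightarrow>
   (nat \<Rightarrow> real ^ 'n) \<Rightarrow> (nat \<Rightarrow> real ^ 'n) \<Rightarrow> (nat \<Rightarrow> real ^ 'n) \<Rightarrow> bool" where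
  "system_I A zl zu N z au al D \<longleftrightarrow>
     slack_dynamics A zl zu N z au al D \<and>
     (\<forall>k<N. \<forall>i.
        ((A *v z k) $ i \<le> zu $ i \<longrightarrow> au k $ i = 1) \<and>
        ((A *v z k) $ i > zu $ i \<longrightarrow> au k $ i = 0) \<and>
        ((A *v z k) $ i \<ge> zl $ i \<longrightarrow> al k $ i = 1) \<and>
        ((A *v z k) $ i < zl $ i \<longrightarrow> al k $ i = 0))"

definition system_II ::
  "real ^ 'n ^ 'n \<Rightarrow> real ^ 'n \<Rightarrow> real ^ 'n \<Rightarrow> nat \<Rightarrow> (nat \<Rightarrow> real ^ 'n) \<Rightarrow>
   (nat \<Rightarrow> real ^ 'n) \<Rightarrow> (nat \<Rightarrow> real ^ 'n) \<Rightarrow> (nat \<Rightarrow> real ^ 'n) \<Rightarrow> bool" where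
  "system_II A zl zu N z au al D \<longleftrightarrow>
     slack_dynamics A zl zu N z au al D \<and>
     (\<forall>k<N. \<forall>i.
        au k $ i \<in> {0, 1} \<and> al k $ i \<in> {0, 1} \<and>
        D k $ i \<ge> zu $ i - zl $ i) \<and>
     (\<forall>k<N. z (Suc k) \<in> {zl..zu})"

text \<open>
  For fixed multipliers, (II) does not imply (I): if \<open>(A *v z k) $ i = zu $ i\<close>, then (II) also admits
  \<open>au k $ i = 0\<close> and (I) does not; likewise for \<open>zl\<close> and \<open>al\<close>. If \<open>zl $ i = zu $ i = 0\<close>, then (II)
  also admits \<open>au k $ i = al k $ i = 0\<close>, whatever \<open>(A *v z k) $ i\<close> is. The next predicate excludes
  exactly these cases; none of them alters the trajectory \<open>z\<close>.
\<close>

definition nondegenerate ::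
  "real ^ 'n ^ 'n \<Rightarrow> real ^ 'n \<Rightarrow> real ^ 'n \<Rightarrow> nat \<Rightarrow> (nat \<Rightarrow> real ^ 'n) \<Rightarrow> bool" where
  "nondegenerate A zl zu N z \<longleftrightarrow>
     (\<forall>k<N. \<forall>i. (A *v z k) $ i \<noteq> zu $ i \<and> (A *v z k) $ i \<noteq> zl $ i \<and>
              \<not> (zl $ i = 0 \<and> zu $ i = 0))"

end

theory Submission
  imports Defs
begin

text \<open>
  For each coordinate, put \<open>w = (A *v z k) $ i\<close>. Condition (f) forces \<open>w \<le> zl $ i\<close> when the
  multipliers \<open>(au, al)\<close> are \<open>(1, 0)\<close> and \<open>w \<ge> zu $ i\<close> when they are \<open>(0, 1)\<close>; for \<open>(1, 1)\<close> it is
  (g) that keeps \<open>w\<close> in the interval. The choice \<open>(0, 0)\<close> survives (f) and (g) only if both bounds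
  vanish. In every case \<open>z (Suc k) $ i\<close> is the clamp of \<open>w\<close>, which is also what (I) prescribes, and
  the multipliers of (I) can be recovered from the sign of \<open>w - zl $ i\<close> and \<open>zu $ i - w\<close>.
\<close>

text \<open>For \<open>a = b = 0\<close>, \<open>d = 0\<close> forces \<open>l = u\<close>; then
  \<open>z' = l + u\<close> stays between the bounds only if both are 0, so \<open>z'\<close> is
  still the clamp.\<close>

lemma slack_binary_imp_clamp:
  fixes a b w l u z' d :: real
  assumes "l \<le> u" "a \<in> {0, 1}" "b \<in> {0, 1}"
    and "z' = a * b * w + (1 - a) * u + (1 - b) * l"
    and "d = a * (u - w) + b * (w - l)" "u - l \<le> d" "l \<le> z'" "z' \<le> u"
  shows "z' = max l (min u w)"
  using assms by (auto simp: max_def min_def)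

text \<open>The pairs \<open>(1, 0)\<close> and \<open>(0, 1)\<close> give only
  \<open>w \<le> l\<close> and \<open>u \<le> w\<close>; excluding ties makes these strict, and the
  last premise rules out \<open>(0, 0)\<close>.\<close>

lemma slack_binary_imp_switching:
  fixes a b w l u z' d :: real
  assumes "l \<le> u" "a \<in> {0, 1}" "b \<in> {0, 1}"
    and "z' = a * b * w + (1 - a) * u + (1 - b) * l"
    and "d = a * (u - w) + b * (w - l)" "u - l \<le> d" "l \<le> z'" "z' \<le> u"
    and "w \<noteq> u" "w \<noteq> l" "\<not> (l = 0 \<and> u = 0)"
  shows "(w \<le> u \<longrightarrow> a = 1) \<and> (u < w \<longrightarrow> a = 0) \<and> (l \<le> w \<longrightarrow> b = 1) \<and> (w < l \<longrightarrow> b = 0)"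
  using assms by auto

text \<open>Since \<open>l \<le> u\<close>, \<open>w\<close> cannot violate both bounds, so
  \<open>(0, 0)\<close> never occurs. Otherwise \<open>d\<close> exceeds \<open>u - l\<close> by
  exactly the distance of \<open>w\<close> from the interval.\<close>

lemma slack_switching_imp_binary:
  fixes a b w l u z' d :: real
  assumes "l \<le> u"
    and "z' = a * b * w + (1 - a) * u + (1 - b) * l"
    and "d = a * (u - w) + b * (w - l)"
    and "w \<le> u \<longrightarrow> a = 1" "u < w \<longrightarrow> a = 0" "l \<le> w \<longrightarrow> b = 1" "w < l \<longrightarrow> b = 0"
  shows "a \<in> {0, 1} \<and> b \<in> {0, 1} \<and> u - l \<le> d \<and> l \<le> z' \<and> z' \<le> u"
  using assms by (cases "w \<le> u"; cases "l \<le> w") auto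

text \<open>Splitting the box into coordinates makes each pair \<open>k\<close>, \<open>i\<close> an
  instance of the scalar lemmas.\<close>

lemma system_II_iff:
  "system_II A zl zu N z au al D \<longleftrightarrow>
     (\<forall>k<N. \<forall>i.
        z (Suc k) $ i = au k $ i * al k $ i * ((A *v z k) $ i)
                        + (1 - au k $ i) * zu $ i + (1 - al k $ i) * zl $ i \<and>
        D k $ i = au k $ i * (zu $ i - (A *v z k) $ i)
                  + al k $ i * ((A *v z k) $ i - zl $ i) \<and>
        au k $ i \<in> {0, 1} \<and> al k $ i \<in> {0, 1} \<and>
        zu $ i - zl $ i \<le> D k $ i \<and> zl $ i \<le> z (Suc k) $ i \<and> z (Suc k) $ i \<le> zu $ i)"
  unfolding system_II_def slack_dynamics_def atLeastAtMost_iff less_eq_vec_def by blast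

lemma system_I_imp_system_II:
  assumes "\<forall>i. zl $ i \<le> zu $ i" and "system_I A zl zu N z au al D"
  shows "system_II A zl zu N z au al D"
  unfolding system_II_iff
proof (intro allI impI)
  fix k i
  assume "k < N"
  with assms(2) have
    dyn: "z (Suc k) $ i = au k $ i * al k $ i * ((A *v z k) $ i)
                          + (1 - au k $ i) * zu $ i + (1 - al k $ i) * zl $ i"
         "D k $ i = au k $ i * (zu $ i - (A *v z k) $ i) + al k $ i * ((A *v z k) $ i - zl $ i)"
    and sw: "(A *v z k) $ i \<le> zu $ i \<longrightarrow> au k $ i = 1" "zu $ i < (A *v z k) $ i \<longrightarrow> au k $ i = 0"
            "zl $ i \<le> (A *v z k) $ i \<longrightarrow> al k $ i = 1" "(A *v z k) $ i < zl $ i \<longrightarrow> al k $ i = 0"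
    unfolding system_I_def slack_dynamics_def by blast+
  show "z (Suc k) $ i = au k $ i * al k $ i * ((A *v z k) $ i)
                        + (1 - au k $ i) * zu $ i + (1 - al k $ i) * zl $ i \<and>
        D k $ i = au k $ i * (zu $ i - (A *v z k) $ i)
                  + al k $ i * ((A *v z k) $ i - zl $ i) \<and>
        au k $ i \<in> {0, 1} \<and> al k $ i \<in> {0, 1} \<and>
        zu $ i - zl $ i \<le> D k $ i \<and> zl $ i \<le> z (Suc k) $ i \<and> z (Suc k) $ i \<le> zu $ i"
    using dyn slack_switching_imp_binary[OF assms(1)[rule_format] dyn sw] by blast
qed

lemma system_II_imp_clamp:
  assumes "\<forall>i. zl $ i \<le> zu $ i" and "system_II A zl zu N z au al D" and "k < N"
  shows "z (Suc k) $ i = max (zl $ i) (min (zu $ i) ((A *v z k) $ i))"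
  using assms(2)[unfolded system_II_iff, rule_format, OF assms(3), of i]
  by (elim conjE) (rule slack_binary_imp_clamp[OF assms(1)[rule_format]])

text \<open>The clamp formula mentions no multipliers, so a trajectory of (II) can be given fresh
  ones that obey (c) and (d).\<close>

lemma clamp_imp_ex_system_I:
  assumes "\<forall>i. zl $ i \<le> zu $ i"
    and "\<And>k i. k < N \<Longrightarrow> z (Suc k) $ i = max (zl $ i) (min (zu $ i) ((A *v z k) $ i))"
  shows "\<exists>au al D. system_I A zl zu N z au al D"
proof -
  \<comment> \<open>Ties get the value 1, as (c) and (d) demand.\<close>
  define au :: "nat \<Rightarrow> real ^ 'a"
    where "au k = (\<chi> i. if (A *v z k) $ i \<le> zu $ i then 1 else 0)" for k
  define al :: "nat \<Rightarrow> real ^ 'a"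
    where "al k = (\<chi> i. if (A *v z k) $ i \<ge> zl $ i then 1 else 0)" for k
  define D :: "nat \<Rightarrow> real ^ 'a"
    where "D k = (\<chi> i. au k $ i * (zu $ i - (A *v z k) $ i)
                       + al k $ i * ((A *v z k) $ i - zl $ i))" for k
  have "z (Suc k) $ i = au k $ i * al k $ i * ((A *v z k) $ i)
          + (1 - au k $ i) * zu $ i + (1 - al k $ i) * zl $ i" if "k < N" for k i
    using assms(1)[rule_format, of i] assms(2)[OF that, of i]
    by (auto simp: au_def al_def max_def min_def)
  \<comment> \<open>With only \<open>D\<close> unfolded, (a) matches the equation just proved and
    (b) is trivial; the switching rules then follow from \<open>au\<close> and
    \<open>al\<close>.\<close>
  then have "system_I A zl zu N z au al D"
    unfolding system_I_def slack_dynamics_def by (simp add: D_def) (simp add: au_def al_def)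
  then show ?thesis
    by blast
qed

lemma nondegenerate_system_II_imp_system_I:
  assumes "\<forall>i. zl $ i \<le> zu $ i" and "nondegenerate A zl zu N z"
    and "system_II A zl zu N z au al D"
  shows "system_I A zl zu N z au al D"
  unfolding system_I_def
\<comment> \<open>The instantiation keeps the four switching rules together, in the shape of the
  scalar lemma.\<close>
proof (intro conjI[of "slack_dynamics _ _ _ _ _ _ _ _"] allI impI)
  show "slack_dynamics A zl zu N z au al D"
    using assms(3) unfolding system_II_def by blast
next
  fix k i
  assume k: "k < N"
  have nd: "(A *v z k) $ i \<noteq> zu $ i" "(A *v z k) $ i \<noteq> zl $ i" "\<not> (zl $ i = 0 \<and> zu $ i = 0)"
    using assms(2) k unfolding nondegenerate_def by blast+
  show "((A *v z k) $ i \<le> zu $ i \<longrightarrow> au k $ i = 1) \<and>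
        ((A *v z k) $ i > zu $ i \<longrightarrow> au k $ i = 0) \<and>
        ((A *v z k) $ i \<ge> zl $ i \<longrightarrow> al k $ i = 1) \<and>
        ((A *v z k) $ i < zl $ i \<longrightarrow> al k $ i = 0)"
    using assms(3)[unfolded system_II_iff, rule_format, OF k, of i]
    by (elim conjE) (rule slack_binary_imp_switching[OF assms(1)[rule_format] _ _ _ _ _ _ _ nd])
qed

text \<open>Ties and zero bounds break the equivalence for fixed multipliers, so it is stated for
  trajectories, and for fixed multipliers only under \<open>nondegenerate\<close>.\<close>

theorem mainTheorem1:
  fixes A :: "real ^ 'n ^ 'n"
    and zl zu :: "real ^ 'n"
    and N :: nat
    and z au al D :: "nat \<Rightarrow> real ^ 'n"
  assumes "N \<ge> 1"
    and "\<forall>i. zl $ i \<le> zu $ i"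
  shows "((\<exists>au' al' D'. system_I A zl zu N z au' al' D') \<longleftrightarrow>
          (\<exists>au' al' D'. system_II A zl zu N z au' al' D')) \<and>
         (system_I A zl zu N z au al D \<longrightarrow> system_II A zl zu N z au al D) \<and>
         (nondegenerate A zl zu N z \<longrightarrow>
            (system_I A zl zu N z au al D \<longleftrightarrow> system_II A zl zu N z au al D))"
proof (intro conjI impI)
  show "(\<exists>au' al' D'. system_I A zl zu N z au' al' D') \<longleftrightarrow>
        (\<exists>au' al' D'. system_II A zl zu N z au' al' D')"
  proof
    assume "\<exists>au' al' D'. system_I A zl zu N z au' al' D'"
    then show "\<exists>au' al' D'. system_II A zl zu N z au' al' D'"
      using system_I_imp_system_II[OF assms(2)] by blast
  next
    assume "\<exists>au' al' D'. system_II A zl zu N z au' al' D'"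
    then obtain au' al' D' where "system_II A zl zu N z au' al' D'"
      by blast
    then show "\<exists>au' al' D'. system_I A zl zu N z au' al' D'"
      by (intro clamp_imp_ex_system_I[OF assms(2)] system_II_imp_clamp[OF assms(2)])
  qed
next
  assume "system_I A zl zu N z au al D"
  then show "system_II A zl zu N z au al D"
    by (rule system_I_imp_system_II[OF assms(2)])
next
  assume "nondegenerate A zl zu N z"
  then show "system_I A zl zu N z au al D \<longleftrightarrow> system_II A zl zu N z au al D"
    using system_I_imp_system_II[OF assms(2)] nondegenerate_system_II_imp_system_I[OF assms(2)]
    by blast
qed

end
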